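(* Assume that $\mathcal{X}$ is convex, $F$ is convex, and $G(\cdot,y)$ is linear for every $y\in\mathcal{Y}$. Assume that there are linear mappings $x\mapsto Q(x)\in\mathbb{S}_n$, $x\mapsto q(x)\in\mathbb{R}^n$, $x\mapsto b(x)\in\mathbb{R}$ on $\mathbb{R}^m$ with $G(x,y)=-\frac12 y^\top Q(x)y+q(x)^\top y+b(x)$, that there are $Q^1,\dots,Q^r\in\mathbb{S}_n$, $q^1,\dots,q^r\in\mathbb{R}^n$, $b_1,\dots,b_r\in\mathbb{R}$ with $\mathcal{Y}=\{y\in\mathbb{R}^n : \frac12 y^\top Q^jy+(q^j)^\top y+b_j\le 0,\ \forall j\in\{1,\dots,r\}\}$, and that $\rho\ge 0$ satisfies $\mathcal{Y}\subset B(0,\rho)$. Assume that $F$ is $C_F$-Lipschitz and that there exists $x^S\in\mathcal{X}$ such that $\phi_{\mathsf{SDP}}(x^S)<0$. If the inner-outer approximation (IOA) algorithm with a $\delta$-oracle, $\delta\in[0,1)$, does not stop, then it generates infinite sequences $(x^k)_{k\in\mathbb{N}^+}$ and $(\hat{x}^k)_{k\in\mathbb{N}^+}$ such that (i) $\lVert x^k-\hat{x}^k\rVert\to 0$, and (ii) the sequence $(\hat{x}^k)$ consists of feasible points of (SIP) and is a minimizing sequence, i.e., $F(\hat{x}^k)\to\mathsf{val}(\mathrm{SIP})$.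
   Context: Setting. $m,n$ are positive integers, $F:\mathbb{R}^m\to\mathbb{R}$ and $G:\mathbb{R}^m\times\mathbb{R}^n\to\mathbb{R}$ are continuous, $\mathcal{X}\subset\mathbb{R}^m$ and $\mathcal{Y}\subset\mathbb{R}^n$ are non-empty and compact. (SIP) is $\min_{x\in\mathcal{X}}F(x)$ s.t. $G(x,y)\le 0$ for all $y\in\mathcal{Y}$; $\mathsf{val}$ denotes optimal value; $\phi(x)=\max_{y\in\mathcal{Y}}G(x,y)$. $\mathbb{S}_n$ is the set of symmetric real $n\times n$ matrices, $\langle A,B\rangle=\mathsf{Tr}(A^\top B)$, $B(0,\rho)$ is the Euclidean ball of radius $\rho$ centered at $0$, norms are Euclidean, $\mathbb{N}^+=\{1,2,\dots\}$. Define $\mathcal{Q}(x)=\frac12\begin{pmatrix}-Q(x)&q(x)\\ q(x)^\top&2b(x)\end{pmatrix}$, $\mathcal{Q}^j=\frac12\begin{pmatrix}Q^j&q^j\\ (q^j)^\top&2b_j\end{pmatrix}$ in $\mathbb{S}_{n+1}$, $I_{n+1}$ the identity, $E=\mathsf{diag}(0,\dots,0,1)\in\mathbb{S}_{n+1}$. $\phi_{\mathsf{SDP}}(x)$ is the optimal value of: maximize $\langle\mathcal{Q}(x),Y\rangle$ over $Y\in\mathbb{S}_{n+1}$ s.t. $\langle\mathcal{Q}^j,Y\rangle\le 0$ for $j=1,\dots,r$, $\langle I_{n+1},Y\rangle\le 1+\rho^2$, $\langle E,Y\rangle=1$, $Y\succeq 0$. (SIPR) is the problem: minimize $F(x)$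 over $x\in\mathcal{X},\lambda\in\mathbb{R}^r_+,\alpha\in\mathbb{R}_+,\beta\in\mathbb{R}$ s.t. $\alpha(1+\rho^2)+\beta\le 0$ and $\sum_j\lambda_j\mathcal{Q}^j+\alpha I_{n+1}+\beta E-\mathcal{Q}(x)\succeq 0$. $\delta$-oracle ($\delta\in[0,1)$): for every $x\in\mathcal{X}$ it returns $\hat{y}(x)\in\mathcal{Y}$ and $\hat{v}(x)\ge\phi(x)$ with $\hat{v}(x)-G(x,\hat{y}(x))\le\delta|\phi(x)|$. IOA algorithm (input: a $\delta$-oracle, tolerances $\epsilon_1,\epsilon_2\ge 0$, bounds $0<\underline{\mu}\le\overline{\mu}$). Initialization: solve (SIPR), obtaining $\hat{x}^{\mathrm{init}}$; if $Q(\hat{x}^{\mathrm{init}})\succ 0$ and $Q^1,\dots,Q^r\succeq 0$, stop and return $\hat{x}^{\mathrm{init}}$. Otherwise set $\mathcal{Y}^0=\emptyset$ and run iterations $k=0,1,2,\dots$: (1) choose $\mu_k\in[\underline{\mu},\overline{\mu}]$ and compute an optimal solution $(x^k,\hat{x}^k)$ of $\min_{x,\hat{x}\in\mathcal{X}}F(x)+F(\hat{x})+\frac{\mu_k}{2}\lVert x-\hat{x}\rVert^2$ s.t. $G(x,y)\le 0$ for all $y\in\mathcal{Y}^k$ and $\hat{x}\in\mathcal{R}^k$; (2) call the oracle at $x^k$ to get $y^k=\hat{y}(x^k)$ and $v_k=\hat{v}(x^k)$; (3) set $\mathcal{Y}^{k+1}=\mathcal{Y}^k\cup\{y^k\}$;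 (4) stop and return $(x^k,\hat{x}^k)$ if $G(x^k,y^k)\le\epsilon_1$ and $\lVert x^k-\hat{x}^k\rVert\le\epsilon_2$, else go to iteration $k+1$. Here $\mathcal{R}^k$ is the set of $\hat{x}\in\mathbb{R}^m$ for which there exist $\lambda\in\mathbb{R}^r_+$, $\alpha\in\mathbb{R}_+$, $\beta\in\mathbb{R}$ and $\zeta_\ell\ge 0$ ($0\le\ell\le k-1$) such that $\alpha(1+\rho^2)+\beta+\sum_{\ell=0}^{k-1}\zeta_\ell v_\ell\le 0$ and $\sum_{j=1}^r\lambda_j\mathcal{Q}^j+\sum_{\ell=0}^{k-1}\zeta_\ell\mathcal{Q}(x^\ell)+\alpha I_{n+1}+\beta E\succeq\mathcal{Q}(\hat{x})$. *)

theory Defs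
  imports "HOL-Analysis.Analysis"
begin

definition psd :: "real^'n^'n \<Rightarrow> bool" where
  "psd A \<longleftrightarrow> transpose A = A \<and> (\<forall>z. 0 \<le> z \<bullet> (A *v z))"

definition posdef :: "real^'n^'n \<Rightarrow> bool" where
  "posdef A \<longleftrightarrow> transpose A = A \<and> (\<forall>z. z \<noteq> 0 \<longrightarrow> 0 < z \<bullet> (A *v z))"

definition frob :: "real^'n^'n \<Rightarrow> real^'n^'n \<Rightarrow> real" where
  "frob A B = trace (transpose A ** B)"

text \<open>
  Matrices of size \<open>n + 1\<close> are indexed by \<open>'n option\<close>, where \<open>None\<close> is the last index:
  \<open>bordered A a c\<close> is the block matrix with rows \<open>(A, a)\<close> and \<open>(a\<^sup>T, c)\<close>.
\<close>

definition bordered ::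
    "real^'n^'n \<Rightarrow> real^'n \<Rightarrow> real \<Rightarrow> real^('n::finite option)^('n option)" where
  "bordered A a c = (\<chi> i j.
     (case i of
        Some i' \<Rightarrow> (case j of Some j' \<Rightarrow> A $ i' $ j' | None \<Rightarrow> a $ i')
      | None \<Rightarrow> (case j of Some j' \<Rightarrow> a $ j' | None \<Rightarrow> c)))"

definition corner :: "real^('n::finite option)^('n option)" where
  "corner = bordered 0 0 1"

definition lift_obj ::
    "(real^'m \<Rightarrow> real^'n^'n) \<Rightarrow> (real^'m \<Rightarrow> real^'n) \<Rightarrow> (real^'m \<Rightarrow> real)
     \<Rightarrow> real^'m \<Rightarrow> real^('n::finite option)^('n option)" where
  "lift_obj Q q b x = (1/2) *\<^sub>R bordered (- Q x) (q x) (2 * b x)"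

definition lift_con ::
    "(nat \<Rightarrow> real^'n^'n) \<Rightarrow> (nat \<Rightarrow> real^'n) \<Rightarrow> (nat \<Rightarrow> real)
     \<Rightarrow> nat \<Rightarrow> real^('n::finite option)^('n option)" where
  "lift_con Qc qc bc j = (1/2) *\<^sub>R bordered (Qc j) (qc j) (2 * bc j)"

definition sip_feasible ::
    "(real^'m \<Rightarrow> real^'n \<Rightarrow> real) \<Rightarrow> (real^'m) set \<Rightarrow> (real^'n) set \<Rightarrow> (real^'m) set" where
  "sip_feasible G X Y = {x \<in> X. \<forall>y\<in>Y. G x y \<le> 0}"

definition sip_val ::
    "(real^'m \<Rightarrow> real) \<Rightarrow> (real^'m \<Rightarrow> real^'n \<Rightarrow> real) \<Rightarrow> (real^'m) set \<Rightarrow> (real^'n) set \<Rightarrow> ereal"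
  where
  "sip_val F G X Y = (INF x \<in> sip_feasible G X Y. ereal (F x))"

text \<open>
  The real supremum below is only used for non-empty compact \<open>Y\<close> and continuous \<open>G x\<close>,
  where it is the maximum.
\<close>

definition lower_level_val ::
    "(real^'m \<Rightarrow> real^'n \<Rightarrow> real) \<Rightarrow> (real^'n) set \<Rightarrow> real^'m \<Rightarrow> real" where
  "lower_level_val G Y x = (SUP y \<in> Y. G x y)"

definition sdp_feasible ::
    "(nat \<Rightarrow> real^('n::finite option)^('n option)) \<Rightarrow> nat \<Rightarrow> real
     \<Rightarrow> (real^('n option)^('n option)) set" where
  "sdp_feasible QC r \<rho> =
     {Z. (\<forall>j\<in>{1..r}. frob (QC j) Z \<le> 0) \<and> frob (mat 1) Z \<le> 1 + \<rho>\<^sup>2 \<and>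
         frob corner Z = 1 \<and> psd Z}"

definition phi_SDP ::
    "(real^'m \<Rightarrow> real^('n::finite option)^('n option))
     \<Rightarrow> (nat \<Rightarrow> real^('n option)^('n option)) \<Rightarrow> nat \<Rightarrow> real \<Rightarrow> real^'m \<Rightarrow> ereal" where
  "phi_SDP QQ QC r \<rho> x = (SUP Z \<in> sdp_feasible QC r \<rho>. ereal (frob (QQ x) Z))"

definition sipr_feasible ::
    "(real^'m) set \<Rightarrow> (real^'m \<Rightarrow> real^('n::finite option)^('n option))
     \<Rightarrow> (nat \<Rightarrow> real^('n option)^('n option)) \<Rightarrow> nat \<Rightarrow> real
     \<Rightarrow> ((real^'m) \<times> (nat \<Rightarrow> real) \<times> real \<times> real) set" where
  "sipr_feasible X QQ QC r \<rho> =
     {(x, lam, \<alpha>, \<beta>). x \<in> X \<and> (\<forall>j\<in>{1..r}. 0 \<le> lam j) \<and> 0 \<le> \<alpha> \<and>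
        \<alpha> * (1 + \<rho>\<^sup>2) + \<beta> \<le> 0 \<and>
        psd ((\<Sum>j=1..r. lam j *\<^sub>R QC j) + \<alpha> *\<^sub>R mat 1 + \<beta> *\<^sub>R corner - QQ x)}"

definition sipr_solution ::
    "(real^'m \<Rightarrow> real) \<Rightarrow> (real^'m) set \<Rightarrow> (real^'m \<Rightarrow> real^('n::finite option)^('n option))
     \<Rightarrow> (nat \<Rightarrow> real^('n option)^('n option)) \<Rightarrow> nat \<Rightarrow> real \<Rightarrow> real^'m \<Rightarrow> bool" where
  "sipr_solution F X QQ QC r \<rho> x \<longleftrightarrow>
     (\<exists>lam \<alpha> \<beta>. is_arg_min (\<lambda>(x, _). F x) (\<lambda>p. p \<in> sipr_feasible X QQ QC r \<rho>) (x, lam, \<alpha>, \<beta>))"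

definition delta_oracle ::
    "(real^'m \<Rightarrow> real^'n \<Rightarrow> real) \<Rightarrow> (real^'m) set \<Rightarrow> (real^'n) set \<Rightarrow> real
     \<Rightarrow> (real^'m \<Rightarrow> real^'n) \<Rightarrow> (real^'m \<Rightarrow> real) \<Rightarrow> bool" where
  "delta_oracle G X Y \<delta> yo vo \<longleftrightarrow>
     (\<forall>x\<in>X. yo x \<in> Y \<and> lower_level_val G Y x \<le> vo x \<and>
            vo x - G x (yo x) \<le> \<delta> * \<bar>lower_level_val G Y x\<bar>)"

text \<open>
  Dual feasibility with value at most \<open>0\<close>, for the relaxation in \<open>phi_SDP\<close> at \<open>xh\<close> with the
  additional constraints \<open>frob (QQ (xs l)) Z \<le> vs l\<close> for \<open>l < k\<close>. Membership of \<open>x\<close> in the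
  case \<open>k = 0\<close> is the constraint on \<open>x\<close> in \<open>sipr_feasible\<close>.
\<close>

definition inner_region ::
    "(real^'m \<Rightarrow> real^('n::finite option)^('n option))
     \<Rightarrow> (nat \<Rightarrow> real^('n option)^('n option)) \<Rightarrow> nat \<Rightarrow> real
     \<Rightarrow> (nat \<Rightarrow> real^'m) \<Rightarrow> (nat \<Rightarrow> real) \<Rightarrow> nat \<Rightarrow> (real^'m) set" where
  "inner_region QQ QC r \<rho> xs vs k =
     {xh. \<exists>lam \<alpha> \<beta> \<zeta>.
        (\<forall>j\<in>{1..r}. 0 \<le> lam j) \<and> 0 \<le> \<alpha> \<and> (\<forall>l<k. 0 \<le> \<zeta> l) \<and>
        \<alpha> * (1 + \<rho>\<^sup>2) + \<beta> + (\<Sum>l<k. \<zeta> l * vs l) \<le> (0::real) \<and>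
        psd ((\<Sum>j=1..r. lam j *\<^sub>R QC j) + (\<Sum>l<k. \<zeta> l *\<^sub>R QQ (xs l))
             + \<alpha> *\<^sub>R mat 1 + \<beta> *\<^sub>R corner - QQ xh)}"

definition master_solution ::
    "(real^'m \<Rightarrow> real) \<Rightarrow> (real^'m \<Rightarrow> real^'n \<Rightarrow> real) \<Rightarrow> (real^'m) set
     \<Rightarrow> (real^'n) set \<Rightarrow> (real^'m) set \<Rightarrow> real \<Rightarrow> real^'m \<Rightarrow> real^'m \<Rightarrow> bool" where
  "master_solution F G X C R \<mu> x xh \<longleftrightarrow>
     is_arg_min (\<lambda>(x, xh). F x + F xh + \<mu> / 2 * (norm (x - xh))\<^sup>2)
       (\<lambda>(x, xh). x \<in> X \<and> xh \<in> X \<and> (\<forall>y\<in>C. G x y \<le> 0) \<and> xh \<in> R) (x, xh)"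

definition init_stop :: "(real^'m \<Rightarrow> real^'n^'n) \<Rightarrow> (nat \<Rightarrow> real^'n^'n) \<Rightarrow> nat \<Rightarrow> real^'m \<Rightarrow> bool" where
  "init_stop Q Qc r xinit \<longleftrightarrow> posdef (Q xinit) \<and> (\<forall>j\<in>{1..r}. psd (Qc j))"

definition iter_stop ::
    "(real^'m \<Rightarrow> real^'n \<Rightarrow> real) \<Rightarrow> real \<Rightarrow> real
     \<Rightarrow> (nat \<Rightarrow> real^'m) \<Rightarrow> (nat \<Rightarrow> real^'m) \<Rightarrow> (nat \<Rightarrow> real^'n) \<Rightarrow> nat \<Rightarrow> bool" where
  "iter_stop G \<epsilon>1 \<epsilon>2 x xh y k \<longleftrightarrow> G (x k) (y k) \<le> \<epsilon>1 \<and> norm (x k - xh k) \<le> \<epsilon>2"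

text \<open>
  An execution of the algorithm. \<open>N\<close> is the set of indices of the iterations that are
  carried out, and the sequences are constrained only at indices in \<open>N\<close>. The set of cuts
  of iteration \<open>k\<close> is \<open>y ` {..<k}\<close>. The subproblem solutions and the weights \<open>\<mu> k\<close> are
  arbitrary admissible choices.
\<close>

definition ioa_execution ::
    "(real^'m \<Rightarrow> real) \<Rightarrow> (real^'m \<Rightarrow> real^'n \<Rightarrow> real) \<Rightarrow> (real^'m) set
     \<Rightarrow> (real^'m \<Rightarrow> real^'n^'n) \<Rightarrow> (real^'m \<Rightarrow> real^'n) \<Rightarrow> (real^'m \<Rightarrow> real)
     \<Rightarrow> (nat \<Rightarrow> real^'n^'n) \<Rightarrow> (nat \<Rightarrow> real^'n) \<Rightarrow> (nat \<Rightarrow> real) \<Rightarrow> nat \<Rightarrow> real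
     \<Rightarrow> (real^'m \<Rightarrow> real^'n) \<Rightarrow> (real^'m \<Rightarrow> real) \<Rightarrow> real \<Rightarrow> real \<Rightarrow> real \<Rightarrow> real
     \<Rightarrow> real^'m \<Rightarrow> nat set \<Rightarrow> (nat \<Rightarrow> real)
     \<Rightarrow> (nat \<Rightarrow> real^'m) \<Rightarrow> (nat \<Rightarrow> real^'m) \<Rightarrow> (nat \<Rightarrow> real^'n) \<Rightarrow> (nat \<Rightarrow> real) \<Rightarrow> bool" where
  "ioa_execution F G X Q q b Qc qc bc r \<rho> yo vo \<epsilon>1 \<epsilon>2 \<mu>lo \<mu>hi xinit N \<mu> x xh y v \<longleftrightarrow>
     sipr_solution F X (lift_obj Q q b) (lift_con Qc qc bc) r \<rho> xinit \<and>
     (0 \<in> N \<longleftrightarrow> \<not> init_stop Q Qc r xinit) \<and>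
     (\<forall>k. Suc k \<in> N \<longleftrightarrow> k \<in> N \<and> \<not> iter_stop G \<epsilon>1 \<epsilon>2 x xh y k) \<and>
     (\<forall>k\<in>N. \<mu> k \<in> {\<mu>lo..\<mu>hi} \<and>
        master_solution F G X (y ` {..<k})
          (inner_region (lift_obj Q q b) (lift_con Qc qc bc) r \<rho> x v k) (\<mu> k) (x k) (xh k) \<and>
        y k = yo (x k) \<and> v k = vo (x k))"

definition ioa_stops ::
    "(real^'m \<Rightarrow> real^'n \<Rightarrow> real) \<Rightarrow> (real^'m \<Rightarrow> real^'n^'n) \<Rightarrow> (nat \<Rightarrow> real^'n^'n) \<Rightarrow> nat
     \<Rightarrow> real \<Rightarrow> real \<Rightarrow> real^'m \<Rightarrow> nat set
     \<Rightarrow> (nat \<Rightarrow> real^'m) \<Rightarrow> (nat \<Rightarrow> real^'m) \<Rightarrow> (nat \<Rightarrow> real^'n) \<Rightarrow> bool" where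
  "ioa_stops G Q Qc r \<epsilon>1 \<epsilon>2 xinit N x xh y \<longleftrightarrow>
     init_stop Q Qc r xinit \<or> (\<exists>k\<in>N. iter_stop G \<epsilon>1 \<epsilon>2 x xh y k)"

end

theory Submission
  imports Defs
begin

text \<open>
  The objective and constraint matrices are built so that \<open>G x y\<close> and the constraints of \<open>Y\<close> are
  their pairings with the rank-one matrix \<open>D\<^sub>y = (y, 1) (y, 1)\<^sup>T\<close>, which is feasible for the
  semidefinite relaxation whenever \<open>y \<in> Y\<close>. Testing the matrix inequality in the inner region
  against \<open>D\<^sub>y\<close> is weak duality: it shows that every \<open>xh k\<close> is feasible for the semi-infinite
  problem (\<open>inner_region_nonpos\<close>).

  Convergence has two ingredients. The outer one is the usual cutting-plane argument: in a compact
  set the iterate \<open>x k\<close> is eventually close to a later iterate, which satisfies the cut made at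
  \<open>x k\<close>. So the violation at \<open>x k\<close>, and with it the bound \<open>v k\<close>, becomes at most an arbitrarily
  small positive number (\<open>oracle_bound_eventually_small\<close>). The inner one uses the Slater point \<open>xS\<close>.
  By strong duality for the relaxation, proved here by separation, \<open>xS\<close> has a dual certificate of
  value \<open>- c < 0\<close> (\<open>sdp_dual_certificate\<close>), while for \<open>l < k\<close> the iterate \<open>x l\<close> has, through the
  multiplier \<open>\<zeta> l = 1\<close>, one of value \<open>v l\<close>. Certificates combine convexly, so a point on the segment
  from \<open>x l\<close> to \<open>xS\<close> that is close to \<open>x l\<close> belongs to all later inner regions once \<open>v l\<close> is small
  (\<open>inner_region_segment\<close>). By compactness \<open>x k\<close> is close to some earlier \<open>x l\<close>, hence to a point
  \<open>p\<close> of its own inner region.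

  It remains to compare the optimal pair \<open>(x k, xh k)\<close> of the subproblem with three competitors:
  \<open>(x k, p)\<close> and \<open>(xh k, xh k)\<close>, which force \<open>\<mu> k * (norm (x k - xh k))\<^sup>2\<close> to vanish in the limit, and
  \<open>(xh k + s (w - xh k), xh k)\<close> for a feasible \<open>w\<close>, where convexity makes the gain linear in \<open>s\<close> but
  the penalty quadratic in \<open>s\<close>, so that \<open>F (xh k)\<close> cannot stay above \<open>F w\<close>
  (\<open>inner_outer_convergence\<close>).
\<close>

section \<open>Rank-one matrices and the lifting of quadratic forms\<close>

definition dyad :: "real^'k \<Rightarrow> real^'k^'k" where
  "dyad z = (\<chi> i j. z $ i * z $ j)"

text \<open>
  The index \<open>None\<close> carries the constant coordinate, so that quadratic functions of \<open>y\<close> are quadratic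
  forms in \<open>homogenize y\<close>.
\<close>

definition homogenize :: "real^'n \<Rightarrow> real^('n::finite option)" where
  "homogenize y = (\<chi> i. case i of Some i' \<Rightarrow> y $ i' | None \<Rightarrow> 1)"

lemma frob_eq_inner: "frob A B = A \<bullet> B"
  unfolding frob_def trace_def matrix_matrix_mult_def transpose_def inner_vec_def
  by (simp add: sum.swap[of "\<lambda>i k. A $ k $ i * B $ k $ i"])

lemma inner_dyad: "A \<bullet> dyad z = z \<bullet> (A *v z)"
  unfolding dyad_def inner_vec_def matrix_vector_mult_def
  by (simp add: sum_distrib_left mult_ac)

lemma inner_dyad_dyad: "dyad z \<bullet> dyad z = (z \<bullet> z)\<^sup>2"
  unfolding dyad_def inner_vec_def
  by (simp add: power2_eq_square sum_product mult_ac)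

lemma norm_dyad: "norm (dyad z) = (norm z)\<^sup>2"
  by (simp add: norm_eq_sqrt_inner inner_dyad_dyad)

lemma transpose_dyad [simp]: "transpose (dyad z) = dyad z"
  by (simp add: dyad_def transpose_def vec_eq_iff mult.commute)

lemma inner_transpose: "transpose A \<bullet> transpose B = A \<bullet> (B :: real^'k^'k)"
  unfolding inner_vec_def transpose_def
  by (simp add: sum.swap[of "\<lambda>i k. A $ k $ i * B $ k $ i"])

lemma psd_iff_dyad: "psd A \<longleftrightarrow> transpose A = A \<and> (\<forall>z. 0 \<le> A \<bullet> dyad z)"
  by (simp add: psd_def inner_dyad)

lemma psd_dyad: "psd (dyad z)"
proof -
  have "dyad z \<bullet> dyad w = (z \<bullet> w)\<^sup>2" for w
    unfolding dyad_def inner_vec_def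
    by (simp add: power2_eq_square sum_product mult_ac)
  then show ?thesis
    by (simp add: psd_iff_dyad)
qed

lemma mat_1_inner_dyad: "mat 1 \<bullet> dyad z = (norm z)\<^sup>2"
  by (simp add: inner_dyad power2_norm_eq_inner)

lemma sum_UNIV_option:
  "(\<Sum>i\<in>UNIV. f i) = f None + (\<Sum>i\<in>UNIV. f (Some i))"
  for f :: "'n::finite option \<Rightarrow> real"
  by (simp add: UNIV_option_conv sum.reindex)

lemma bordered_inner_dyad:
  "bordered A a c \<bullet> dyad (homogenize y) = y \<bullet> (A *v y) + 2 * (a \<bullet> y) + c"
  unfolding bordered_def dyad_def homogenize_def inner_vec_def matrix_vector_mult_def
  by (simp add: sum_UNIV_option sum.distrib sum_distrib_left mult_ac)

lemma norm_homogenize: "(norm (homogenize y))\<^sup>2 = 1 + (norm y)\<^sup>2"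
  unfolding homogenize_def power2_norm_eq_inner inner_vec_def
  by (simp add: sum_UNIV_option)

lemma corner_inner_dyad: "corner \<bullet> dyad (homogenize y) = 1"
  by (simp add: corner_def bordered_inner_dyad)

lemma transpose_bordered: "transpose A = A \<Longrightarrow> transpose (bordered A a c) = bordered A a c"
  by (auto simp: bordered_def transpose_def vec_eq_iff split: option.splits)

lemma transpose_linear:
  fixes A B :: "real^'k^'k"
  shows "transpose (A + B) = transpose A + transpose B"
    and "transpose (A - B) = transpose A - transpose B"
    and "transpose (c *\<^sub>R A) = c *\<^sub>R transpose A"
    and "transpose (sum M S) = (\<Sum>j\<in>S. transpose (M j :: real^'k^'k))"
  by (simp_all add: transpose_def vec_eq_iff)

lemma lift_obj_inner_dyad:
  "lift_obj Q q b x \<bullet> dyad (homogenize y) = - (1/2) * (y \<bullet> (Q x *v y)) + q x \<bullet> y + b x"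
proof -
  have "(- Q x) *v y = - (Q x *v y)"
    by (simp add: matrix_vector_mult_def vec_eq_iff sum_negf)
  then show ?thesis
    by (simp add: lift_obj_def bordered_inner_dyad algebra_simps)
qed

lemma lift_con_inner_dyad:
  "lift_con Qc qc bc j \<bullet> dyad (homogenize y) = 1/2 * (y \<bullet> (Qc j *v y)) + qc j \<bullet> y + bc j"
  by (simp add: lift_con_def bordered_inner_dyad algebra_simps)

lemma transpose_lift_obj:
  "transpose (Q x) = Q x \<Longrightarrow> transpose (lift_obj Q q b x) = lift_obj Q q b x"
  unfolding lift_obj_def transpose_linear
  by (subst transpose_bordered) (simp_all add: transpose_def vec_eq_iff)

lemma transpose_lift_con:
  "transpose (Qc j) = Qc j \<Longrightarrow> transpose (lift_con Qc qc bc j) = lift_con Qc qc bc j"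
  by (simp add: lift_con_def transpose_linear transpose_bordered)

lemma transpose_corner: "transpose corner = corner"
  unfolding corner_def by (rule transpose_bordered) (simp add: transpose_def vec_eq_iff)

lemma linear_lift_obj:
  assumes "linear Q" "linear q" "linear b"
  shows "linear (lift_obj Q q b)"
proof (rule linearI)
  show "lift_obj Q q b (x + y) = lift_obj Q q b x + lift_obj Q q b y" for x y
    using assms[THEN linear_add]
    by (auto simp: lift_obj_def bordered_def vec_eq_iff field_simps split: option.splits)
  show "lift_obj Q q b (c *\<^sub>R x) = c *\<^sub>R lift_obj Q q b x" for c x
    using assms[THEN linear_scale]
    by (auto simp: lift_obj_def bordered_def vec_eq_iff field_simps split: option.splits)
qed

section \<open>Strong duality for the relaxation\<close>

text \<open>
  A theorem of the alternative: the open convex cone of matrices with a positive definite quadratic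
  form can only miss \<open>K\<close> if a hyperplane through \<open>0\<close> separates the two. Its normal \<open>W\<close> is
  non-negative on that cone. The cone consists of matrices that need not be symmetric, and therefore
  \<open>W\<close> must be symmetric; by self-duality it is positive semidefinite. It is then a nonzero dual
  element that no \<open>M \<in> K\<close> pairs with positively.
\<close>

lemma posdef_meets_convex_set:
  fixes K :: "(real^'k^'k) set"
  assumes "convex K" "0 \<in> K"
    and pos: "\<And>W. psd W \<Longrightarrow> 0 < mat 1 \<bullet> W \<Longrightarrow> \<exists>M\<in>K. 0 < M \<bullet> W"
  shows "\<exists>M\<in>K. \<forall>z. z \<noteq> 0 \<longrightarrow> 0 < M \<bullet> dyad z"
proof (rule ccontr)
  define P :: "(real^'k^'k) set" where "P = {M. \<forall>z. z \<noteq> 0 \<longrightarrow> 0 < M \<bullet> dyad z}"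
  assume "\<not> ?thesis"
  then have disj: "K \<inter> P = {}"
    by (auto simp: P_def)
  have "convex P"
    unfolding convex_def
  proof (intro ballI allI impI)
    fix A B :: "real^'k^'k" and u v :: real
    assume *: "A \<in> P" "B \<in> P" "0 \<le> u" "0 \<le> v" "u + v = 1"
    have "0 < u * (A \<bullet> dyad z) + v * (B \<bullet> dyad z)" if "z \<noteq> 0" for z
    proof -
      have "0 < A \<bullet> dyad z" "0 < B \<bullet> dyad z"
        using * that by (auto simp: P_def)
      with * show ?thesis
        by (cases "u = 0") (auto intro!: add_pos_nonneg)
    qed
    then show "u *\<^sub>R A + v *\<^sub>R B \<in> P"
      by (simp add: P_def inner_add_left)
  qed
  have scaled: "t *\<^sub>R mat 1 \<in> P" if "0 < t" for t
    using that by (simp add: P_def mat_1_inner_dyad)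
  then have "P \<noteq> {}"
    using zero_less_one by blast
  then obtain W \<beta> where W: "W \<noteq> 0" "\<And>M. M \<in> K \<Longrightarrow> W \<bullet> M \<le> \<beta>" "\<And>M. M \<in> P \<Longrightarrow> \<beta> \<le> W \<bullet> M"
    using separating_hyperplane_sets[OF \<open>convex K\<close> \<open>convex P\<close> _ _ disj] \<open>0 \<in> K\<close> by blast
  have "0 \<le> \<beta>"
    using W(2)[OF \<open>0 \<in> K\<close>] by simp
  then have WP: "0 \<le> W \<bullet> M" if "M \<in> P" for M
    using W(3)[OF that] by simp
  have "\<beta> \<le> 0"
  proof (rule field_le_epsilon)
    fix e :: real assume "0 < e"
    define t where "t = e / (1 + \<bar>W \<bullet> mat 1\<bar>)"
    have "0 < t"
      using \<open>0 < e\<close> by (simp add: t_def add_pos_nonneg)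
    have "\<beta> \<le> t * (W \<bullet> mat 1)"
      using W(3)[OF scaled[OF \<open>0 < t\<close>]] by simp
    also have "\<dots> \<le> t * (1 + \<bar>W \<bullet> mat 1\<bar>)"
      using \<open>0 < t\<close> by (intro mult_left_mono) auto
    also have "\<dots> = e"
      by (simp add: t_def)
    finally show "\<beta> \<le> 0 + e" by simp
  qed
  \<comment> \<open>Adding multiples of an antisymmetric matrix does not leave \<open>P\<close>, so \<open>W\<close> is orthogonal to all of
    them, in particular to its own antisymmetric part.\<close>
  have sym: "transpose W = W"
  proof -
    define A where "A = W - transpose W"
    have A: "A \<bullet> dyad z = 0" for z
      using inner_transpose[of W "dyad z"] by (simp add: A_def inner_diff_left)
    have "0 \<le> W \<bullet> mat 1 - s * (W \<bullet> A)" for s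
    proof -
      have "mat 1 - s *\<^sub>R A \<in> P"
        by (simp add: P_def inner_diff_left A mat_1_inner_dyad)
      from WP[OF this] show ?thesis
        by (simp add: inner_diff_right)
    qed
    from this[of "(W \<bullet> mat 1 + 1) / (W \<bullet> A)"] have "W \<bullet> A = 0"
      by (cases "W \<bullet> A = 0") auto
    moreover have "A \<bullet> A = 2 * (W \<bullet> A)"
      using inner_transpose[of W W] by (simp add: A_def inner_diff_left inner_diff_right inner_commute)
    ultimately show ?thesis
      by (simp add: A_def)
  qed
  have "0 \<le> W \<bullet> dyad z" for z
  proof (rule field_le_epsilon)
    fix e :: real assume "0 < e"
    define t where "t = e / (1 + \<bar>W \<bullet> mat 1\<bar>)"
    have "0 < t"
      using \<open>0 < e\<close> by (simp add: t_def add_pos_nonneg)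
    then have "dyad z + t *\<^sub>R mat 1 \<in> P"
      using psd_dyad[of z]
      by (auto simp: P_def psd_iff_dyad inner_add_left mat_1_inner_dyad intro!: add_nonneg_pos)
    from WP[OF this] have "0 \<le> W \<bullet> dyad z + t * (W \<bullet> mat 1)"
      by (simp add: inner_add_right)
    also have "t * (W \<bullet> mat 1) \<le> t * (1 + \<bar>W \<bullet> mat 1\<bar>)"
      using \<open>0 < t\<close> by (intro mult_left_mono) auto
    also have "\<dots> = e"
      by (simp add: t_def)
    finally show "0 \<le> W \<bullet> dyad z + e" by simp
  qed
  then have "psd W"
    by (simp add: psd_iff_dyad sym)
  moreover have "0 < mat 1 \<bullet> W"
  proof -
    \<comment> \<open>The identity is interior to \<open>P\<close>, so it can be moved a little against \<open>W\<close>.\<close>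
    define t where "t = 1 / (2 * norm W)"
    have "0 < t"
      using W(1) by (simp add: t_def)
    have "mat 1 - t *\<^sub>R W \<in> P"
      unfolding P_def
    proof (intro CollectI allI impI)
      fix z :: "real^'k" assume "z \<noteq> 0"
      have "t * (W \<bullet> dyad z) \<le> t * (norm W * (norm z)\<^sup>2)"
        using \<open>0 < t\<close> norm_cauchy_schwarz[of W "dyad z"] by (simp add: norm_dyad)
      also have "\<dots> = (norm z)\<^sup>2 / 2"
        using W(1) by (simp add: t_def)
      also have "\<dots> < (norm z)\<^sup>2"
        using \<open>z \<noteq> 0\<close> by simp
      finally show "0 < (mat 1 - t *\<^sub>R W) \<bullet> dyad z"
        by (simp add: inner_diff_left mat_1_inner_dyad)
    qed
    from WP[OF this] have "t * (W \<bullet> W) \<le> mat 1 \<bullet> W"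
      by (simp add: inner_diff_right inner_commute)
    moreover have "0 < t * (W \<bullet> W)"
      using \<open>0 < t\<close> W(1) by simp
    ultimately show ?thesis
      by linarith
  qed
  ultimately obtain M where "M \<in> K" "0 < M \<bullet> W"
    using pos by blast
  with W(2)[of M] \<open>\<beta> \<le> 0\<close> show False
    by (simp add: inner_commute)
qed


text \<open>
  The dual certificate is sought in the cone generated by the constraint matrices, the trace
  constraint made homogeneous with the corner constraint, and the negated objective. If no element of
  this cone is positive definite, then by \<open>posdef_meets_convex_set\<close> some nonzero semidefinite \<open>W\<close>
  satisfies all homogeneous constraints; the trace constraint makes its corner positive, so it
  can be rescaled to a feasible point with objective value at least \<open>- c\<close>. A positive definite element
  yields the certificate after division by the weight \<open>\<tau>\<close> of the objective, which is positive
  because otherwise the element would be non-positive on the feasible point \<open>dyad z\<close>.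
  The homogeneous form covers \<open>\<rho> = 0\<close>, where no feasible point satisfies the trace constraint
  strictly.
\<close>

lemma sdp_dual_certificate:
  assumes QC: "\<And>j. j \<in> {1..r} \<Longrightarrow> transpose (QC j) = QC j" and A: "transpose A = A"
    and z: "dyad z \<in> sdp_feasible QC r \<rho>"
    and neg: "\<And>Z. Z \<in> sdp_feasible QC r \<rho> \<Longrightarrow> A \<bullet> Z < - c" and "0 < c"
  shows "\<exists>lam \<alpha> \<beta>. (\<forall>j\<in>{1..r}. 0 \<le> lam j) \<and> 0 \<le> \<alpha> \<and> \<alpha> * (1 + \<rho>\<^sup>2) + \<beta> \<le> - c \<and>
    psd ((\<Sum>j=1..r. lam j *\<^sub>R QC j) + \<alpha> *\<^sub>R mat 1 + \<beta> *\<^sub>R corner - A)"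
proof -
  define J :: "real^'a option^'a option" where "J = mat 1 - (1 + \<rho>\<^sup>2) *\<^sub>R corner"
  define B where "B = A + c *\<^sub>R corner"
  define comb where
    "comb = (\<lambda>lam \<alpha> \<tau>. (\<Sum>j=1..r. lam j *\<^sub>R QC j) + \<alpha> *\<^sub>R J - \<tau> *\<^sub>R B)"
  define K where "K = {comb lam \<alpha> \<tau> | lam \<alpha> \<tau>. (\<forall>j\<in>{1..r}. 0 \<le> lam j) \<and> 0 \<le> \<alpha> \<and> 0 \<le> \<tau>}"
  have KI: "comb lam \<alpha> \<tau> \<in> K" if "\<forall>j\<in>{1..r}. 0 \<le> lam j" "0 \<le> \<alpha>" "0 \<le> \<tau>" for lam \<alpha> \<tau>
    using that unfolding K_def by blast
  have "convex K"
    unfolding convex_def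
  proof (intro ballI allI impI)
    fix M M' :: "real^'a option^'a option" and u w :: real
    assume "M \<in> K" "M' \<in> K" and uw: "0 \<le> u" "0 \<le> w"
    then obtain lam \<alpha> \<tau> lam' \<alpha>' \<tau>' where
      M: "M = comb lam \<alpha> \<tau>" "\<forall>j\<in>{1..r}. 0 \<le> lam j" "0 \<le> \<alpha>" "0 \<le> \<tau>" and
      M': "M' = comb lam' \<alpha>' \<tau>'" "\<forall>j\<in>{1..r}. 0 \<le> lam' j" "0 \<le> \<alpha>'" "0 \<le> \<tau>'"
      unfolding K_def by blast
    have "u *\<^sub>R M + w *\<^sub>R M' = comb (\<lambda>j. u * lam j + w * lam' j) (u * \<alpha> + w * \<alpha>') (u * \<tau> + w * \<tau>')"
      unfolding M M' comb_def
      by (simp add: scaleR_sum_right sum.distrib scaleR_add_left scaleR_add_right scaleR_diff_right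
          scaleR_left.diff)
    also have "\<dots> \<in> K"
      using M M' uw by (intro KI) auto
    finally show "u *\<^sub>R M + w *\<^sub>R M' \<in> K" .
  qed
  moreover have "0 \<in> K"
    using KI[of "\<lambda>_. 0" 0 0] by (simp add: comb_def)
  moreover have "\<exists>M\<in>K. 0 < M \<bullet> W" if W: "psd W" "0 < mat 1 \<bullet> W" for W
  proof (rule ccontr)
    assume "\<not> ?thesis"
    then have le: "comb lam \<alpha> \<tau> \<bullet> W \<le> 0"
      if "\<forall>j\<in>{1..r}. 0 \<le> lam j" "0 \<le> \<alpha>" "0 \<le> \<tau>" for lam \<alpha> \<tau>
      using KI[OF that] by force
    have con: "QC j \<bullet> W \<le> 0" if "j \<in> {1..r}" for j
    proof -
      have "(\<Sum>i=1..r. (if i = j then 1 else 0) *\<^sub>R QC i) = QC j"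
        using that by (simp add: if_distrib[of "\<lambda>a. a *\<^sub>R _"] cong: if_cong)
      then show ?thesis
        using le[of "\<lambda>i. if i = j then 1 else 0" 0 0] by (simp add: comb_def)
    qed
    have tr: "mat 1 \<bullet> W \<le> (1 + \<rho>\<^sup>2) * (corner \<bullet> W)"
      using le[of "\<lambda>_. 0" 1 0] by (simp add: comb_def J_def inner_diff_left)
    have obj: "0 \<le> A \<bullet> W + c * (corner \<bullet> W)"
      using le[of "\<lambda>_. 0" 0 1] by (simp add: comb_def B_def inner_add_left inner_diff_left)
    have E: "0 < corner \<bullet> W"
    proof -
      have "0 < (1 + \<rho>\<^sup>2) * (corner \<bullet> W)"
        using W(2) tr by linarith
      then show ?thesis
        by (simp add: zero_less_mult_iff add_nonneg_eq_0_iff)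
           (smt (verit) zero_le_power2)
    qed
    define Z where "Z = (1 / (corner \<bullet> W)) *\<^sub>R W"
    have "Z \<in> sdp_feasible QC r \<rho>"
      using W(1) con tr E unfolding sdp_feasible_def Z_def
      by (auto simp: frob_eq_inner psd_iff_dyad transpose_linear field_simps)
    from neg[OF this] have "A \<bullet> W < - c * (corner \<bullet> W)"
      using E by (simp add: Z_def field_simps)
    with obj show False by simp
  qed
  ultimately obtain M where "M \<in> K" and Mpos: "\<And>z. z \<noteq> 0 \<Longrightarrow> 0 < M \<bullet> dyad z"
    using posdef_meets_convex_set[of K] by blast
  then obtain lam \<alpha> \<tau> where
    M: "M = comb lam \<alpha> \<tau>" and lam: "\<forall>j\<in>{1..r}. 0 \<le> lam j" and \<alpha>: "0 \<le> \<alpha>" and "0 \<le> \<tau>"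
    unfolding K_def by blast
  have "\<tau> \<noteq> 0"
  proof
    assume "\<tau> = 0"
    have z': "QC j \<bullet> dyad z \<le> 0" if "j \<in> {1..r}" for j
      using z that by (simp add: sdp_feasible_def frob_eq_inner)
    have "z \<noteq> 0"
      using z by (auto simp: sdp_feasible_def frob_eq_inner inner_dyad)
    then have "0 < M \<bullet> dyad z"
      by (rule Mpos)
    also have "\<dots> = (\<Sum>j=1..r. lam j * (QC j \<bullet> dyad z))
        + \<alpha> * (mat 1 \<bullet> dyad z - (1 + \<rho>\<^sup>2) * (corner \<bullet> dyad z))"
      by (simp add: M comb_def J_def \<open>\<tau> = 0\<close> inner_sum_left inner_add_left inner_diff_left)
    also have "\<dots> \<le> 0 + 0"
      using z lam \<alpha> z'
      by (intro add_mono sum_nonpos mult_nonneg_nonpos) (auto simp: sdp_feasible_def frob_eq_inner)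
    finally show False by simp
  qed
  with \<open>0 \<le> \<tau>\<close> have \<tau>: "0 < \<tau>" by simp
  define \<beta> where "\<beta> = - (\<alpha> / \<tau>) * (1 + \<rho>\<^sup>2) - c"
  define N where "N = (\<Sum>j=1..r. (lam j / \<tau>) *\<^sub>R QC j) + (\<alpha> / \<tau>) *\<^sub>R mat 1
    + \<beta> *\<^sub>R corner - A"
  have \<tau>\<beta>: "\<tau> * \<beta> = - (\<alpha> * (1 + \<rho>\<^sup>2)) - \<tau> * c"
    using \<tau> by (simp add: \<beta>_def field_simps)
  have "\<tau> *\<^sub>R N = (\<Sum>j=1..r. lam j *\<^sub>R QC j) + \<alpha> *\<^sub>R mat 1 + (\<tau> * \<beta>) *\<^sub>R corner - \<tau> *\<^sub>R A"
    using \<tau> by (simp add: N_def scaleR_sum_right scaleR_add_right scaleR_diff_right)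
  also have "\<dots> = M"
    unfolding \<tau>\<beta> by (simp add: M comb_def J_def B_def algebra_simps)
  finally have "\<tau> * (N \<bullet> dyad z) = M \<bullet> dyad z" for z
    by (simp flip: inner_scaleR_left)
  moreover have "0 \<le> M \<bullet> dyad z" for z
    using Mpos[of z] by (cases "z = 0") (auto simp: inner_dyad)
  ultimately have "0 \<le> \<tau> * (N \<bullet> dyad z)" for z
    by simp
  then have "0 \<le> N \<bullet> dyad z" for z
    using \<tau> by (simp add: zero_le_mult_iff)
  moreover have "transpose N = N"
    using QC A by (auto simp: N_def transpose_linear transpose_corner transpose_mat intro!: sum.cong)
  ultimately have "psd N"
    by (simp only: psd_iff_dyad) simp
  moreover have "\<alpha> / \<tau> * (1 + \<rho>\<^sup>2) + \<beta> \<le> - c"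
    by (simp add: \<beta>_def)
  ultimately show ?thesis
    using lam \<alpha> \<tau> unfolding N_def
    by (intro exI[of _ "\<lambda>j. lam j / \<tau>"] exI[of _ "\<alpha> / \<tau>"] exI[of _ \<beta>]) simp
qed

text \<open>
  A negative supremum leaves room for a uniform margin \<open>c\<close>, also when it is \<open>- \<infinity>\<close>.
\<close>

lemma phi_SDP_negD:
  assumes "phi_SDP QQ QC r \<rho> x < 0"
  obtains c where "0 < c" "\<And>Z. Z \<in> sdp_feasible QC r \<rho> \<Longrightarrow> QQ x \<bullet> Z < - c"
proof -
  obtain d where d: "phi_SDP QQ QC r \<rho> x < ereal d" "ereal d < 0"
    using ereal_dense2[OF assms] by auto
  have "QQ x \<bullet> Z < - (- d)" if "Z \<in> sdp_feasible QC r \<rho>" for Z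
  proof -
    have "ereal (QQ x \<bullet> Z) \<le> phi_SDP QQ QC r \<rho> x"
      unfolding phi_SDP_def frob_eq_inner using that by (rule SUP_upper)
    then show ?thesis
      using le_less_trans[OF _ d(1)] by fastforce
  qed
  with d(2) show thesis
    by (intro that[of "- d"]) auto
qed

section \<open>The inner regions\<close>

text \<open>
  Weak duality: pairing the matrix inequality with \<open>D\<close> bounds \<open>QQ xh \<bullet> D\<close> by the value of the dual
  certificate.
\<close>

lemma inner_region_nonpos:
  assumes D: "D \<in> sdp_feasible QC r \<rho>" "D = dyad z" and vs: "\<And>l. l < k \<Longrightarrow> QQ (xs l) \<bullet> D \<le> vs l"
    and xh: "xh \<in> inner_region QQ QC r \<rho> xs vs k"
  shows "QQ xh \<bullet> D \<le> 0"
proof -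
  obtain lam \<alpha> \<beta> \<zeta> where lam: "\<forall>j\<in>{1..r}. 0 \<le> lam j" and \<alpha>: "0 \<le> \<alpha>" and \<zeta>: "\<forall>l<k. 0 \<le> \<zeta> l"
    and val: "\<alpha> * (1 + \<rho>\<^sup>2) + \<beta> + (\<Sum>l<k. \<zeta> l * vs l) \<le> 0"
    and psd: "psd ((\<Sum>j=1..r. lam j *\<^sub>R QC j) + (\<Sum>l<k. \<zeta> l *\<^sub>R QQ (xs l))
             + \<alpha> *\<^sub>R mat 1 + \<beta> *\<^sub>R corner - QQ xh)"
    using xh unfolding inner_region_def by blast
  have feas: "\<forall>j\<in>{1..r}. QC j \<bullet> D \<le> 0" "mat 1 \<bullet> D \<le> 1 + \<rho>\<^sup>2" "corner \<bullet> D = 1"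
    using D(1) by (auto simp: sdp_feasible_def frob_eq_inner)
  have "QQ xh \<bullet> D \<le> (\<Sum>j=1..r. lam j * (QC j \<bullet> D)) + (\<Sum>l<k. \<zeta> l * (QQ (xs l) \<bullet> D))
      + \<alpha> * (mat 1 \<bullet> D) + \<beta>"
    using psd feas(3) D(2)
    by (auto simp: psd_iff_dyad inner_sum_left inner_add_left inner_diff_left dest: spec[of _ z])
  also have "\<dots> \<le> 0 + (\<Sum>l<k. \<zeta> l * vs l) + \<alpha> * (1 + \<rho>\<^sup>2) + \<beta>"
    using lam \<alpha> \<zeta> feas vs
    by (intro add_mono sum_nonpos sum_mono mult_nonneg_nonpos mult_left_mono) auto
  also have "\<dots> \<le> 0"
    using val by simp
  finally show ?thesis .
qed

text \<open>
  The certificate at the convex combination is \<open>t\<close> times the one at \<open>s\<close> plus \<open>1 - t\<close> times the one at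
  \<open>xs l\<close>, whose only nonzero multiplier is \<open>\<zeta> l = 1\<close>. Its value is at most \<open>(1 - t) * vs l - t * c\<close>.
\<close>

lemma inner_region_segment:
  assumes lin: "linear QQ" and "l < k" and t: "0 \<le> t" "t \<le> 1" "(1 - t) * vs l \<le> t * c"
    and lam: "\<forall>j\<in>{1..r}. 0 \<le> lam j" and \<alpha>: "0 \<le> \<alpha>" "\<alpha> * (1 + \<rho>\<^sup>2) + \<beta> \<le> - c"
    and psd: "psd ((\<Sum>j=1..r. lam j *\<^sub>R QC j) + \<alpha> *\<^sub>R mat 1 + \<beta> *\<^sub>R corner - QQ s)"
  shows "(1 - t) *\<^sub>R xs l + t *\<^sub>R s \<in> inner_region QQ QC r \<rho> xs vs k"
proof -
  define \<zeta> where "\<zeta> = (\<lambda>i. if i = l then 1 - t else 0)"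
  have sum1: "(\<Sum>i<k. \<zeta> i * vs i) = (1 - t) * vs l"
    using \<open>l < k\<close> by (simp add: \<zeta>_def if_distrib[of "\<lambda>a. a * _"] cong: if_cong)
  have sum2: "(\<Sum>i<k. \<zeta> i *\<^sub>R QQ (xs i)) = (1 - t) *\<^sub>R QQ (xs l)"
    using \<open>l < k\<close> by (simp add: \<zeta>_def if_distrib[of "\<lambda>a. a *\<^sub>R _"] cong: if_cong)
  have "(\<Sum>j=1..r. (t * lam j) *\<^sub>R QC j) + (\<Sum>i<k. \<zeta> i *\<^sub>R QQ (xs i)) + (t * \<alpha>) *\<^sub>R mat 1
      + (t * \<beta>) *\<^sub>R corner - QQ ((1 - t) *\<^sub>R xs l + t *\<^sub>R s)
    = t *\<^sub>R ((\<Sum>j=1..r. lam j *\<^sub>R QC j) + \<alpha> *\<^sub>R mat 1 + \<beta> *\<^sub>R corner - QQ s)"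
    unfolding sum2 linear_add[OF lin] linear_scale[OF lin]
    by (simp add: scaleR_sum_right scaleR_add_right scaleR_diff_right)
  moreover have "psd (t *\<^sub>R ((\<Sum>j=1..r. lam j *\<^sub>R QC j) + \<alpha> *\<^sub>R mat 1 + \<beta> *\<^sub>R corner - QQ s))"
    using psd t(1) by (simp only: psd_iff_dyad transpose_linear(3) inner_scaleR_left) simp
  moreover have "t * \<alpha> * (1 + \<rho>\<^sup>2) + t * \<beta> + (\<Sum>i<k. \<zeta> i * vs i) \<le> 0"
  proof -
    have "t * (\<alpha> * (1 + \<rho>\<^sup>2) + \<beta>) \<le> t * (- c)"
      using \<alpha>(2) t(1) by (rule mult_left_mono)
    then show ?thesis
      using t(3) unfolding sum1 by (simp add: algebra_simps)
  qed
  moreover have "\<forall>j\<in>{1..r}. 0 \<le> t * lam j" "0 \<le> t * \<alpha>" "\<forall>i<k. 0 \<le> \<zeta> i"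
    using lam \<alpha>(1) t by (auto simp: \<zeta>_def)
  ultimately show ?thesis
    unfolding inner_region_def
    by (intro CollectI exI[of _ "\<lambda>j. t * lam j"] exI[of _ "t * \<alpha>"] exI[of _ "t * \<beta>"] exI[of _ \<zeta>])
       simp
qed

section \<open>Cuts on a compact set\<close>

text \<open>
  A convergent subsequence along \<open>I\<close> is a Cauchy sequence.
\<close>

lemma compact_infinite_close_pair:
  fixes x :: "nat \<Rightarrow> 'a::metric_space"
  assumes "compact X" "\<And>k. x k \<in> X" "infinite I" "0 < e"
  shows "\<exists>k\<in>I. \<exists>l\<in>I. k < l \<and> dist (x k) (x l) < e"
proof -
  define s where "s = enumerate I"
  have s: "strict_mono s" "\<And>i. s i \<in> I"
    using assms(3) by (auto simp: s_def enumerate_in_set strict_mono_enumerate)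
  obtain a u where u: "strict_mono u" "((x \<circ> s) \<circ> u) \<longlonglongrightarrow> a"
    using assms(1,2) unfolding compact_def by (metis comp_apply)
  then have "Cauchy ((x \<circ> s) \<circ> u)"
    by (intro LIMSEQ_imp_Cauchy)
  then obtain M where "\<And>i j. i \<ge> M \<Longrightarrow> j \<ge> M \<Longrightarrow> dist (x (s (u i))) (x (s (u j))) < e"
    using \<open>0 < e\<close> unfolding Cauchy_def by (metis comp_apply)
  then have "dist (x (s (u M))) (x (s (u (Suc M)))) < e"
    by simp
  moreover have "s (u M) < s (u (Suc M))"
    using s(1) u(1) by (simp add: strict_mono_less)
  ultimately show ?thesis
    using s(2) by blast
qed

text \<open>
  The indices from \<open>M\<close> on that violate the claim are pairwise \<open>e\<close>-separated, so there are finitely many of them.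
\<close>

lemma eventually_close_earlier:
  fixes x :: "nat \<Rightarrow> 'a::metric_space"
  assumes "compact X" "\<And>k. x k \<in> X" "0 < e"
  shows "\<forall>\<^sub>F k in sequentially. \<exists>l\<ge>M. l < k \<and> dist (x k) (x l) < e"
proof (rule ccontr)
  define B where "B = {k. k \<ge> M \<and> (\<forall>l\<ge>M. l < k \<longrightarrow> e \<le> dist (x k) (x l))}"
  assume "\<not> ?thesis"
  then have "\<exists>k\<ge>max m M. \<not> (\<exists>l\<ge>M. l < k \<and> dist (x k) (x l) < e)" for m
    unfolding eventually_sequentially by blast
  then have "\<exists>k\<ge>m. k \<in> B" for m
    unfolding B_def mem_Collect_eq by (meson max.bounded_iff not_le)
  then have "infinite B"
    by (simp add: infinite_nat_iff_unbounded_le)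
  then obtain k l where "k \<in> B" "l \<in> B" "k < l" "dist (x k) (x l) < e"
    using compact_infinite_close_pair[of X x B e] assms by auto
  then show False
    by (auto simp: B_def dist_commute)
qed

lemma eventually_close_later:
  fixes x :: "nat \<Rightarrow> 'a::metric_space"
  assumes "compact X" "\<And>k. x k \<in> X" "0 < e"
  shows "\<forall>\<^sub>F k in sequentially. \<exists>l>k. dist (x k) (x l) < e"
proof (rule ccontr)
  define B where "B = {k. \<forall>l>k. e \<le> dist (x k) (x l)}"
  assume "\<not> ?thesis"
  then have "\<exists>k\<ge>m. \<not> (\<exists>l>k. dist (x k) (x l) < e)" for m
    unfolding eventually_sequentially by blast
  then have "\<exists>k\<ge>m. k \<in> B" for m
    unfolding B_def mem_Collect_eq by (meson not_le)
  then have "infinite B"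
    by (simp add: infinite_nat_iff_unbounded_le)
  then obtain k l where "k \<in> B" "k < l" "dist (x k) (x l) < e"
    using compact_infinite_close_pair[of X x B e] assms by auto
  then show False
    by (auto simp: B_def)
qed

lemma lower_level_val_upper:
  assumes "continuous_on UNIV (\<lambda>(x, y). G x y)" "compact Y" "y \<in> Y"
  shows "G x y \<le> lower_level_val G Y x"
proof -
  have "continuous_on Y (\<lambda>y. (x, y))"
    by (intro continuous_intros)
  then have "continuous_on Y (\<lambda>y. G x y)"
    using continuous_on_compose2[OF assms(1), of Y "\<lambda>y. (x, y)"] by auto
  then have "bdd_above (G x ` Y)"
    using assms(2) by (intro bounded_imp_bdd_above compact_imp_bounded compact_continuous_image)
  then show ?thesis
    unfolding lower_level_val_def using assms(3) by (rule cSUP_upper[rotated])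
qed

text \<open>
  A later iterate close to \<open>x k\<close> satisfies the cut made at \<open>x k\<close>, so \<open>G (x k) (yo (x k))\<close> is almost
  non-positive by uniform continuity. The relative accuracy \<open>\<delta> < 1\<close> turns this into a bound on the
  lower level value \<open>p\<close> at \<open>x k\<close>, then on \<open>vo (x k)\<close>. If \<open>p < 0\<close>, the returned bound is at most
  \<open>(1 - \<delta>) * p\<close>, hence negative as well.
\<close>

lemma oracle_bound_eventually_small:
  assumes G: "continuous_on UNIV (\<lambda>(x, y). G x y)" and X: "compact X" and Y: "compact Y"
    and yvo: "delta_oracle G X Y \<delta> yo vo" and \<delta>: "0 \<le> \<delta>" "\<delta> < 1"
    and x: "\<And>k. x k \<in> X" and cuts: "\<And>k l. l < k \<Longrightarrow> G (x k) (yo (x l)) \<le> 0"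
    and e: "0 < e"
  shows "\<forall>\<^sub>F k in sequentially. vo (x k) < e"
proof -
  have "uniformly_continuous_on (X \<times> Y) (\<lambda>(x, y). G x y)"
    using G X Y by (intro compact_uniformly_continuous compact_Times) (auto intro: continuous_on_subset)
  moreover have "0 < (1 - \<delta>) * e"
    using \<delta> e by simp
  ultimately obtain d where "0 < d" and
    d: "\<And>a a'. a \<in> X \<times> Y \<Longrightarrow> a' \<in> X \<times> Y \<Longrightarrow> dist a' a < d \<Longrightarrow>
      dist (case a' of (x, y) \<Rightarrow> G x y) (case a of (x, y) \<Rightarrow> G x y) < (1 - \<delta>) * e"
    unfolding uniformly_continuous_on_def by meson
  have "vo (x k) < e" if "l > k" "dist (x k) (x l) < d" for k l
  proof -
    define p where "p = lower_level_val G Y (x k)"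
    define g where "g = G (x k) (yo (x k))"
    have o: "yo (x k) \<in> Y" "p \<le> vo (x k)" "vo (x k) - g \<le> \<delta> * \<bar>p\<bar>"
      using yvo x[of k] by (auto simp: delta_oracle_def p_def g_def)
    have "dist g (G (x l) (yo (x k))) < (1 - \<delta>) * e"
      using d[of "(x l, yo (x k))" "(x k, yo (x k))"] x o(1) that(2)
      by (simp add: dist_Pair_Pair g_def)
    with cuts[OF that(1)] have g: "g < (1 - \<delta>) * e"
      by (auto simp: dist_real_def)
    show ?thesis
    proof (cases "0 \<le> p")
      case True
      then have "(1 - \<delta>) * p < (1 - \<delta>) * e"
        using o(2,3) g by (simp add: algebra_simps)
      then have "p < e"
        using \<delta> by simp
      then have "\<delta> * p \<le> \<delta> * e"
        using \<delta> by (intro mult_left_mono) auto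
      then show ?thesis
        using o(3) g True by (simp add: algebra_simps)
    next
      case False
      have "g \<le> p"
        unfolding g_def p_def using G Y o(1) by (rule lower_level_val_upper)
      then have "vo (x k) \<le> (1 - \<delta>) * p"
        using o(3) False by (simp add: algebra_simps)
      also have "\<dots> \<le> 0"
        using False \<delta> by (intro mult_nonneg_nonpos) auto
      finally show ?thesis
        using e by simp
    qed
  qed
  then show ?thesis
    using eventually_close_later[of X x, OF X x \<open>0 < d\<close>] by (auto elim!: eventually_mono)
qed

section \<open>Convergence of the inner-outer scheme\<close>

text \<open>
  Here \<open>S\<close> is the feasible set, \<open>obj k\<close> the objective of the \<open>k\<close>-th subproblem, and \<open>inner\<close> says that
  \<open>x k\<close> is nearly a competitor for \<open>xh k\<close>. The latter gives
  \<open>F (xh k) + \<mu> k / 2 * (d k)\<^sup>2 < F (x k) + \<eta>\<close>, where \<open>d k = norm (x k - xh k)\<close>, and the competitor \<open>xh k\<close>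
  for \<open>x k\<close> gives \<open>F (x k) + \<mu> k / 2 * (d k)\<^sup>2 \<le> F (xh k)\<close>. Adding the two shows that \<open>d k\<close> vanishes in
  the limit. Moving \<open>xh k\<close> by a fraction \<open>s\<close> towards \<open>w\<close> shows that \<open>s * (F (xh k) - F w)\<close> is at most
  \<open>\<eta>\<close> plus a term of order \<open>s\<^sup>2\<close>; taking \<open>s\<close> small and then \<open>\<eta>\<close> small compared with \<open>s\<close> gives the
  second claim.
\<close>

lemma inner_outer_convergence:
  fixes F :: "'a::real_inner \<Rightarrow> real" and x xh :: "nat \<Rightarrow> 'a" and \<mu> :: "nat \<Rightarrow> real"
  defines "obj k a c \<equiv> F a + F c + \<mu> k / 2 * (norm (a - c))\<^sup>2"
  assumes F: "convex_on UNIV F" "C-lipschitz_on UNIV F"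
    and S: "convex S" "bounded S" and xh: "\<And>k. xh k \<in> S"
    and \<mu>: "0 < \<mu>lo" "\<And>k. \<mu> k \<in> {\<mu>lo..\<mu>hi}"
    and outer: "\<And>k w. w \<in> S \<Longrightarrow> obj k (x k) (xh k) \<le> obj k w (xh k)"
    and inner: "\<And>e. 0 < e \<Longrightarrow>
      \<forall>\<^sub>F k in sequentially. \<exists>p. norm (x k - p) < e \<and> obj k (x k) (xh k) \<le> obj k (x k) p"
  shows "(\<lambda>k. norm (x k - xh k)) \<longlonglongrightarrow> 0"
    and "w \<in> S \<Longrightarrow> 0 < e \<Longrightarrow> \<forall>\<^sub>F k in sequentially. F (xh k) < F w + e"
proof -
  have C: "0 \<le> C"
    using F(2) by (rule lipschitz_on_nonneg)
  have hi: "0 < \<mu>hi"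
    using \<mu>(1) \<mu>(2)[of 0] by simp
  define d where "d k = norm (x k - xh k)" for k
  have up: "\<forall>\<^sub>F k in sequentially. F (xh k) + \<mu> k / 2 * (d k)\<^sup>2 < F (x k) + \<eta>" if "0 < \<eta>" for \<eta>
  proof -
    \<comment> \<open>With \<open>e \<le> 1\<close> the quadratic penalty at distance \<open>e\<close> is at most linear in \<open>e\<close>, and the total
      increase is below \<open>(C + \<mu>hi) * e\<close>.\<close>
    define e where "e = min 1 (\<eta> / (C + \<mu>hi))"
    have e: "0 < e" "e \<le> 1"
      using that C hi by (auto simp: e_def)
    have "(C + \<mu>hi) * e \<le> (C + \<mu>hi) * (\<eta> / (C + \<mu>hi))"
      using C hi by (intro mult_left_mono) (auto simp: e_def)
    then have e\<eta>: "(C + \<mu>hi) * e \<le> \<eta>"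
      using C hi by simp
    show ?thesis
      using inner[OF e(1)]
    proof (rule eventually_mono, elim exE conjE)
      fix k p assume p: "norm (x k - p) < e" "obj k (x k) (xh k) \<le> obj k (x k) p"
      have "F p - F (x k) \<le> C * norm (x k - p)"
        using lipschitz_onD[OF F(2), of "x k" p] by (auto simp: dist_norm norm_minus_commute)
      also have "\<dots> \<le> C * e"
        using p(1) C by (intro mult_left_mono) auto
      finally have 1: "F p \<le> F (x k) + C * e" by simp
      have "(norm (x k - p))\<^sup>2 \<le> e\<^sup>2"
        using p(1) by (intro power_mono) auto
      also have "\<dots> \<le> e"
        using e by (simp add: power2_eq_square mult_left_le)
      finally have "\<mu> k / 2 * (norm (x k - p))\<^sup>2 \<le> \<mu>hi / 2 * e"
        using \<mu>(2)[of k] \<mu>(1) by (intro mult_mono) auto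
      also have "\<dots> < \<mu>hi * e"
        using hi e by simp
      finally show "F (xh k) + \<mu> k / 2 * (d k)\<^sup>2 < F (x k) + \<eta>"
        using p(2) 1 e\<eta> unfolding obj_def d_def by (simp add: algebra_simps)
    qed
  qed
  have low: "F (x k) + \<mu> k / 2 * (d k)\<^sup>2 \<le> F (xh k)" for k
    using outer[OF xh[of k], of k] unfolding obj_def d_def by simp
  show "(\<lambda>k. norm (x k - xh k)) \<longlonglongrightarrow> 0"
  proof (rule LIMSEQ_I)
    fix e :: real assume "0 < e"
    then have "0 < \<mu>lo * e\<^sup>2"
      using \<mu>(1) by simp
    from up[OF this] obtain M where
      M: "\<And>k. k \<ge> M \<Longrightarrow> F (xh k) + \<mu> k / 2 * (d k)\<^sup>2 < F (x k) + \<mu>lo * e\<^sup>2"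
      unfolding eventually_sequentially by blast
    have "norm (d k - 0) < e" if "k \<ge> M" for k
    proof -
      have "\<mu>lo * (d k)\<^sup>2 \<le> \<mu> k * (d k)\<^sup>2"
        using \<mu>(2)[of k] by (intro mult_right_mono) auto
      also have "\<dots> < \<mu>lo * e\<^sup>2"
        using M[OF that] low[of k] by simp
      finally have "(d k)\<^sup>2 < e\<^sup>2"
        using \<mu>(1) by simp
      then have "d k < e"
        using \<open>0 < e\<close> by (simp add: power_less_imp_less_base)
      then show ?thesis
        by (simp add: d_def)
    qed
    then show "\<exists>M. \<forall>k\<ge>M. norm (norm (x k - xh k) - 0) < e"
      unfolding d_def by blast
  qed
  show "\<forall>\<^sub>F k in sequentially. F (xh k) < F w + e" if w: "w \<in> S" and e: "0 < e"
  proof -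
    obtain D where D: "\<And>a. a \<in> S \<Longrightarrow> norm a \<le> D"
      using S(2) unfolding bounded_iff by blast
    \<comment> \<open>Two points of \<open>S\<close> are at distance at most \<open>2 * D\<close>; the summand \<open>1\<close> makes \<open>L\<close> positive and the
      estimate for the penalty strict.\<close>
    define L where "L = \<mu>hi * (2 * D)\<^sup>2 + 1"
    have L: "0 < L"
      using hi by (simp add: L_def add_nonneg_pos)
    define s where "s = min 1 (e / L)"
    have s: "0 < s" "s \<le> 1"
      using e L by (auto simp: s_def)
    have "s * L \<le> e / L * L"
      using L by (intro mult_right_mono) (auto simp: s_def)
    then have sL: "s * L \<le> e"
      using L by simp
    have "0 < s * e / 2"
      using s e by simp
    from up[OF this] show ?thesis
    proof (rule eventually_mono)
      fix k assume k: "F (xh k) + \<mu> k / 2 * (d k)\<^sup>2 < F (x k) + s * e / 2"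
      define a where "a = (1 - s) *\<^sub>R xh k + s *\<^sub>R w"
      have "a \<in> S"
        unfolding a_def using S(1) xh w s by (intro convexD) auto
      have "a - xh k = s *\<^sub>R (w - xh k)"
        by (simp add: a_def algebra_simps)
      then have "(norm (a - xh k))\<^sup>2 = s\<^sup>2 * (norm (w - xh k))\<^sup>2"
        by (simp add: power_mult_distrib)
      also have "\<dots> \<le> s\<^sup>2 * (2 * D)\<^sup>2"
        using norm_triangle_ineq4[of w "xh k"] D[OF w] D[OF xh[of k]]
        by (intro mult_left_mono power_mono) auto
      finally have "\<mu> k / 2 * (norm (a - xh k))\<^sup>2 \<le> \<mu>hi / 2 * (s\<^sup>2 * (2 * D)\<^sup>2)"
        using \<mu>(2)[of k] \<mu>(1) by (intro mult_mono) auto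
      also have "\<dots> = s * (s * (L - 1)) / 2"
        by (simp add: L_def power2_eq_square)
      also have "\<dots> < s * e / 2"
      proof -
        have "s * (L - 1) < e"
          using s sL by (simp add: algebra_simps)
        then show ?thesis
          using s by simp
      qed
      finally have 1: "\<mu> k / 2 * (norm (a - xh k))\<^sup>2 < s * e / 2" .
      have 2: "F a \<le> (1 - s) * F (xh k) + s * F w"
        unfolding a_def using F(1) s by (intro convex_onD) auto
      have 3: "0 \<le> \<mu> k / 2 * (d k)\<^sup>2"
        using \<mu>(1) \<mu>(2)[of k] by simp
      have 4: "F (x k) + \<mu> k / 2 * (d k)\<^sup>2 \<le> F a + \<mu> k / 2 * (norm (a - xh k))\<^sup>2"
        using outer[OF \<open>a \<in> S\<close>, of k] unfolding obj_def d_def by simp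
      have "s * F (xh k) < s * (F w + e)"
        using k 1 2 3 4 by (simp add: algebra_simps)
      then show "F (xh k) < F w + e"
        using s by simp
    qed
  qed
qed

section \<open>Convergence of the algorithm\<close>

theorem theorem14:
  fixes F :: "real^'m \<Rightarrow> real"
    and G :: "real^'m \<Rightarrow> real^'n \<Rightarrow> real"
    and X :: "(real^'m) set"
    and Y :: "(real^'n) set"
    and Q :: "real^'m \<Rightarrow> real^'n^'n"
    and q :: "real^'m \<Rightarrow> real^'n"
    and b :: "real^'m \<Rightarrow> real"
    and Qc :: "nat \<Rightarrow> real^'n^'n"
    and qc :: "nat \<Rightarrow> real^'n"
    and bc :: "nat \<Rightarrow> real"
    and r :: nat
    and \<rho> C_F \<delta> \<epsilon>1 \<epsilon>2 \<mu>lo \<mu>hi :: real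
    and xS xinit :: "real^'m"
    and yo :: "real^'m \<Rightarrow> real^'n"
    and vo :: "real^'m \<Rightarrow> real"
    and N :: "nat set"
    and \<mu> v :: "nat \<Rightarrow> real"
    and x xh :: "nat \<Rightarrow> real^'m"
    and y :: "nat \<Rightarrow> real^'n"
  assumes "continuous_on UNIV F"
    and "continuous_on UNIV (\<lambda>(x, y). G x y)"
    and "X \<noteq> {}" and "compact X"
    and "Y \<noteq> {}" and "compact Y"
    and "convex X"
    and "convex_on UNIV F"
    and "\<forall>y\<in>Y. linear (\<lambda>x. G x y)"
    and "linear Q" and "linear q" and "linear b"
    and "\<forall>x. transpose (Q x) = Q x"
    and "\<forall>x y. G x y = - (1/2) * (y \<bullet> (Q x *v y)) + q x \<bullet> y + b x"
    and "\<forall>j\<in>{1..r}. transpose (Qc j) = Qc j"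
    and "Y = {y. \<forall>j\<in>{1..r}. 1/2 * (y \<bullet> (Qc j *v y)) + qc j \<bullet> y + bc j \<le> 0}"
    and "0 \<le> \<rho>" and "Y \<subseteq> cball 0 \<rho>"
    and "C_F-lipschitz_on UNIV F"
    and "xS \<in> X" and "phi_SDP (lift_obj Q q b) (lift_con Qc qc bc) r \<rho> xS < 0"
    and "0 \<le> \<delta>" and "\<delta> < 1"
    and "delta_oracle G X Y \<delta> yo vo"
    and "0 \<le> \<epsilon>1" and "0 \<le> \<epsilon>2"
    and "0 < \<mu>lo" and "\<mu>lo \<le> \<mu>hi"
    and "ioa_execution F G X Q q b Qc qc bc r \<rho> yo vo \<epsilon>1 \<epsilon>2 \<mu>lo \<mu>hi xinit N \<mu> x xh y v"
    and "\<not> ioa_stops G Q Qc r \<epsilon>1 \<epsilon>2 xinit N x xh y"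
  shows "N = UNIV \<and>
    (\<lambda>k. norm (x k - xh k)) \<longlonglongrightarrow> 0 \<and>
    (\<forall>k\<ge>1. xh k \<in> sip_feasible G X Y) \<and>
    (\<lambda>k. ereal (F (xh k))) \<longlonglongrightarrow> sip_val F G X Y"
proof -
  let ?QQ = "lift_obj Q q b" and ?QC = "lift_con Qc qc bc"
  let ?S = "sip_feasible G X Y" and ?R = "inner_region ?QQ ?QC r \<rho> x v"
  note exec = assms(29)[unfolded ioa_execution_def]
  note nstop = assms(30)[unfolded ioa_stops_def]
  have N: "k \<in> N" for k
    using exec nstop by (induction k) auto
  have \<mu>: "\<mu> k \<in> {\<mu>lo..\<mu>hi}" and y: "y k = yo (x k)" and v: "v k = vo (x k)"
    and master: "master_solution F G X (y ` {..<k}) (?R k) (\<mu> k) (x k) (xh k)" for k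
    using exec N by blast+
  have x: "x k \<in> X" and xhX: "xh k \<in> X" and cuts: "l < k \<Longrightarrow> G (x k) (y l) \<le> 0"
    and xhR: "xh k \<in> ?R k" for k l
    using master[of k] by (auto simp: master_solution_def is_arg_min_def)
  have opt: "F (x k) + F (xh k) + \<mu> k / 2 * (norm (x k - xh k))\<^sup>2
      \<le> F a + F a' + \<mu> k / 2 * (norm (a - a'))\<^sup>2"
    if "a \<in> X" "a' \<in> X" "\<forall>l<k. G a (y l) \<le> 0" "a' \<in> ?R k" for k a a'
    using master[of k] that by (force simp: master_solution_def is_arg_min_def not_less)
  have yo: "yo a \<in> Y" "lower_level_val G Y a \<le> vo a" if "a \<in> X" for a
    using assms(24) that by (auto simp: delta_oracle_def)

  have lin: "linear ?QQ"
    using assms(10-12) by (rule linear_lift_obj)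
  have G: "G a w = ?QQ a \<bullet> dyad (homogenize w)" for a w
    using assms(14) by (simp add: lift_obj_inner_dyad)
  have feas: "dyad (homogenize w) \<in> sdp_feasible ?QC r \<rho>" if "w \<in> Y" for w
  proof -
    have "(norm w)\<^sup>2 \<le> \<rho>\<^sup>2"
      using that assms(18) by (intro power_mono) auto
    then show ?thesis
      using that assms(16)
      by (auto simp: sdp_feasible_def frob_eq_inner psd_dyad corner_inner_dyad mat_1_inner_dyad
          norm_homogenize lift_con_inner_dyad)
  qed
  have inner_feas: "a \<in> ?S" if "a \<in> X" "a \<in> ?R k" for a k
  proof -
    have "G a w \<le> 0" if w: "w \<in> Y" for w
    proof -
      have "?QQ (x l) \<bullet> dyad (homogenize w) \<le> v l" for l
        unfolding G[symmetric] v
        using lower_level_val_upper[OF assms(2,6) w] yo(2)[OF x] by (rule order_trans)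
      from inner_region_nonpos[OF feas[OF w] refl this \<open>a \<in> ?R k\<close>] show ?thesis
        by (simp add: G)
    qed
    with that show ?thesis
      by (simp add: sip_feasible_def)
  qed
  have xhS: "xh k \<in> ?S" for k
    using xhX xhR by (rule inner_feas)

  have S_eq: "?S = X \<inter> (\<Inter>w\<in>Y. {a. G a w \<le> 0})"
    by (auto simp: sip_feasible_def)
  have linear_G: "linear (\<lambda>a. G a w)" if "w \<in> Y" for w
    using assms(9) that by blast
  have "convex {a. G a w \<le> 0}" if "w \<in> Y" for w
    using convex_linear_vimage[OF linear_G[OF that], of "{..0}"] by (simp add: vimage_def)
  then have convS: "convex ?S"
    unfolding S_eq using assms(7) by (intro convex_Int convex_INT) auto
  have "closed {a. G a w \<le> 0}" if "w \<in> Y" for w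
    using linear_continuous_on[OF linear_conv_bounded_linear[THEN iffD1, OF linear_G[OF that]]]
    by (intro closed_Collect_le) auto
  then have compS: "compact ?S"
    unfolding S_eq using assms(4) by (intro compact_Int_closed closed_INT) auto

  obtain y0 where "y0 \<in> Y"
    using assms(5) by blast
  obtain c where c: "0 < c" "\<And>Z. Z \<in> sdp_feasible ?QC r \<rho> \<Longrightarrow> ?QQ xS \<bullet> Z < - c"
    using phi_SDP_negD[OF assms(21)] by blast
  obtain lam \<alpha> \<beta> where cert: "\<forall>j\<in>{1..r}. 0 \<le> lam j" "0 \<le> \<alpha>" "\<alpha> * (1 + \<rho>\<^sup>2) + \<beta> \<le> - c"
    "psd ((\<Sum>j=1..r. lam j *\<^sub>R ?QC j) + \<alpha> *\<^sub>R mat 1 + \<beta> *\<^sub>R corner - ?QQ xS)"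
    using sdp_dual_certificate[OF transpose_lift_con transpose_lift_obj
        feas[OF \<open>y0 \<in> Y\<close>] c(2) c(1)] assms(13,15) by blast
  obtain D where "0 < D" and D: "\<And>a. a \<in> X \<Longrightarrow> norm a \<le> D"
    using compact_imp_bounded[OF assms(4)] unfolding bounded_pos by blast

  have inner: "\<forall>\<^sub>F k in sequentially. \<exists>p. norm (x k - p) < e \<and>
      F (x k) + F (xh k) + \<mu> k / 2 * (norm (x k - xh k))\<^sup>2
        \<le> F (x k) + F p + \<mu> k / 2 * (norm (x k - p))\<^sup>2" if "0 < e" for e
  proof -
    \<comment> \<open>Half of \<open>e\<close> is spent on the distance from \<open>x k\<close> to an earlier iterate \<open>x l\<close>, the other half on
      the step of relative length \<open>\<eta>\<close> from \<open>x l\<close> towards \<open>xS\<close>.\<close>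
    define \<eta> where "\<eta> = min 1 (e / (4 * D))"
    have \<eta>: "0 < \<eta>" "\<eta> \<le> 1" "\<eta> * (2 * D) \<le> e / 2"
    proof -
      show "0 < \<eta>" "\<eta> \<le> 1"
        using \<open>0 < e\<close> \<open>0 < D\<close> by (auto simp: \<eta>_def)
      have "\<eta> * (2 * D) \<le> e / (4 * D) * (2 * D)"
        using \<open>0 < D\<close> by (intro mult_right_mono) (auto simp: \<eta>_def)
      then show "\<eta> * (2 * D) \<le> e / 2"
        using \<open>0 < D\<close> by simp
    qed
    have "\<forall>\<^sub>F k in sequentially. vo (x k) < \<eta> * c"
      using assms(2,4,6,24,22,23) x _ mult_pos_pos[OF \<eta>(1) c(1)]
      by (rule oracle_bound_eventually_small) (use cuts y in auto)
    then obtain M where M: "\<And>l. l \<ge> M \<Longrightarrow> vo (x l) < \<eta> * c"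
      unfolding eventually_sequentially by blast
    have "0 < e / 2"
      using \<open>0 < e\<close> by simp
    from eventually_close_earlier[of X x, OF assms(4) x this, of M] show ?thesis
    proof (rule eventually_mono, elim exE conjE)
      fix k l assume l: "M \<le> l" "l < k" "dist (x k) (x l) < e / 2"
      define p where "p = (1 - \<eta>) *\<^sub>R x l + \<eta> *\<^sub>R xS"
      have "(1 - \<eta>) * v l \<le> \<eta> * c"
      proof (cases "0 \<le> v l")
        case True
        then have "(1 - \<eta>) * v l \<le> v l"
          using \<eta> by (simp add: mult_left_le_one_le)
        then show ?thesis
          using M[OF l(1)] v by simp
      next
        case False
        then have "(1 - \<eta>) * v l \<le> 0"
          using \<eta> by (intro mult_nonneg_nonpos) auto
        also have "0 \<le> \<eta> * c"
          using \<eta> c by simp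
        finally show ?thesis .
      qed
      then have pR: "p \<in> ?R k"
        unfolding p_def using lin l(2) \<eta>(1,2) cert
        by (intro inner_region_segment) auto
      have pX: "p \<in> X"
        unfolding p_def using assms(7,20) x \<eta> by (intro convexD) auto
      have "x l - p = \<eta> *\<^sub>R (x l - xS)"
        by (simp add: p_def algebra_simps)
      then have "norm (x l - p) = \<eta> * norm (x l - xS)"
        using \<eta> by simp
      also have "\<dots> \<le> \<eta> * (2 * D)"
        using norm_triangle_ineq4[of "x l" xS] D[OF x[of l]] D[OF assms(20)] \<eta>
        by (intro mult_left_mono) auto
      finally have "norm (x l - p) \<le> e / 2"
        using \<eta>(3) by simp
      then have "norm (x k - p) < e"
        using norm_triangle_ineq[of "x k - x l" "x l - p"] l(3) by (simp add: dist_norm)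
      then show "\<exists>p. norm (x k - p) < e \<and>
          F (x k) + F (xh k) + \<mu> k / 2 * (norm (x k - xh k))\<^sup>2
            \<le> F (x k) + F p + \<mu> k / 2 * (norm (x k - p))\<^sup>2"
        using opt[OF x pX _ pR] cuts by blast
    qed
  qed
  have outer: "F (x k) + F (xh k) + \<mu> k / 2 * (norm (x k - xh k))\<^sup>2
      \<le> F w + F (xh k) + \<mu> k / 2 * (norm (w - xh k))\<^sup>2" if "w \<in> ?S" for k w
    using that yo(1)[OF x] y by (intro opt xhX xhR) (auto simp: sip_feasible_def)
  note conv = inner_outer_convergence[where x = x and xh = xh and \<mu> = \<mu> and S = ?S,
      OF assms(8,19) convS compact_imp_bounded[OF compS] xhS
      assms(27) \<mu> outer inner]

  obtain w where w: "w \<in> ?S" "\<And>a. a \<in> ?S \<Longrightarrow> F w \<le> F a"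
    using continuous_attains_inf[OF compS _ continuous_on_subset[OF assms(1) subset_UNIV]] xhS
    by blast
  have val: "sip_val F G X Y = ereal (F w)"
    unfolding sip_val_def using w by (intro antisym INF_lower INF_greatest) auto
  have "(\<lambda>k. F (xh k)) \<longlonglongrightarrow> F w"
  proof (rule order_tendstoI)
    show "\<forall>\<^sub>F k in sequentially. a < F (xh k)" if "a < F w" for a
      by (intro always_eventually allI less_le_trans[OF that w(2)[OF xhS]])
    show "\<forall>\<^sub>F k in sequentially. F (xh k) < a" if "F w < a" for a
      using conv(2)[OF _ _ w(1), of "a - F w"] that by simp
  qed
  then show ?thesis
    using N conv(1) xhS unfolding val by auto
qed

end
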